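(* Assume that the unperturbed system $\dot x=X^0(x)$ on $\mathscr{M}$ has a $T$-periodic orbit $\gamma(t)$ for some constant $T>0$, and that it has a non-constant $C^3$ first integral $F(x)$ (i.e. $dF(X^0)=0$) near $\Gamma=\{\gamma(t)\mid t\in[0,T)\}$. If the perturbed system $\dot x=X_\varepsilon(x)$ has a $T_\varepsilon$-periodic orbit $\gamma_\varepsilon$ depending $C^2$-smoothly on $\varepsilon$ such that $T_0=T$ and $\gamma_0=\gamma$, then $$\mathscr{I}_{F,\gamma}:=\int_0^T dF(X^1)(\gamma(t))\,dt=0 .$$
   Context: $\mathscr{M}$ is an $n$-dimensional ($n\ge 2$) paracompact oriented $C^3$ real manifold. $\varepsilon$ is a small parameter, $0\le\varepsilon\ll 1$, and $X_\varepsilon$ is a family of vector fields on $\mathscr{M}$ that is $C^2$ with respect to $x$ and $\varepsilon$, with $X_\varepsilon(x)=X^0(x)+\varepsilon X^1(x)+O(\varepsilon^2)$. "Near $\Gamma$" means on some neighborhood of $\Gamma$ in $\mathscr{M}$. *)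

theory Defs
  imports "HOL-Analysis.Analysis" "HOL-Library.Landau_Symbols"
begin

section \<open>Functions of class \<open>C\<^sup>k\<close>\<close>

text \<open>
  All derivatives are taken within \<open>S\<close>. The definition is meant for sets on which the derivative
  within the set is unique: open sets, relatively open subsets of a half-open interval
  \<open>{0..<\<epsilon>\<^sub>0}\<close>, and products of these. At the end point \<open>\<epsilon> = 0\<close> derivatives in \<open>\<epsilon>\<close> are one-sided.
\<close>

primrec C_k_on ::
  "nat \<Rightarrow> 'a::real_normed_vector set \<Rightarrow> ('a \<Rightarrow> 'b::real_normed_vector) \<Rightarrow> bool" where
  "C_k_on 0 S f \<longleftrightarrow> continuous_on S f"
| "C_k_on (Suc k) S f \<longleftrightarrow> f differentiable_on S \<and>
     (\<forall>v. C_k_on k S (\<lambda>x. frechet_derivative f (at x within S) v))"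


section \<open>Oriented manifolds of class \<open>C\<^sup>k\<close>\<close>

definition paracompact_space :: "'m topology \<Rightarrow> bool" where
  "paracompact_space M \<longleftrightarrow>
     (\<forall>\<U>. (\<forall>U\<in>\<U>. openin M U) \<and> \<Union>\<U> = topspace M \<longrightarrow>
        (\<exists>\<V>. (\<forall>V\<in>\<V>. openin M V) \<and> \<Union>\<V> = topspace M \<and>
              (\<forall>V\<in>\<V>. \<exists>U\<in>\<U>. V \<subseteq> U) \<and> locally_finite_in M \<V>))"

text \<open>
  A chart is a pair of a domain and a coordinate map; the values of the coordinate map outside
  the domain are irrelevant.
\<close>

type_synonym ('m, 'n) chart = "'m set \<times> ('m \<Rightarrow> real ^ 'n)"

definition is_chart :: "'m topology \<Rightarrow> ('m, 'n::finite) chart \<Rightarrow> bool" where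
  "is_chart M c \<longleftrightarrow> openin M (fst c) \<and> open (snd c ` fst c) \<and>
     homeomorphic_map (subtopology M (fst c)) (top_of_set (snd c ` fst c)) (snd c)"

definition chart_inv :: "('m, 'n) chart \<Rightarrow> real ^ 'n \<Rightarrow> 'm" where
  "chart_inv c = inv_into (fst c) (snd c)"

definition transition :: "('m, 'n) chart \<Rightarrow> ('m, 'n) chart \<Rightarrow> real ^ 'n \<Rightarrow> real ^ 'n" where
  "transition c c' = snd c' \<circ> chart_inv c"

text \<open>
  The dimension is \<open>CARD('n)\<close>. The \<open>C\<^sup>k\<close> structure and the orientation are both given by the atlas,
  which need not be maximal.
\<close>

definition oriented_manifold ::
  "nat \<Rightarrow> 'm topology \<Rightarrow> ('m, 'n::finite) chart set \<Rightarrow> bool" where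
  "oriented_manifold k M A \<longleftrightarrow>
     Hausdorff_space M \<and> paracompact_space M \<and>
     (\<forall>c\<in>A. is_chart M c) \<and> (\<Union>c\<in>A. fst c) = topspace M \<and>
     (\<forall>c\<in>A. \<forall>c'\<in>A.
        C_k_on k (snd c ` (fst c \<inter> fst c')) (transition c c') \<and>
        (\<forall>x \<in> snd c ` (fst c \<inter> fst c').
           det (matrix (frechet_derivative (transition c c') (at x))) > 0))"

definition C_k_function ::
  "('m, 'n::finite) chart set \<Rightarrow> nat \<Rightarrow> 'm set \<Rightarrow> ('m \<Rightarrow> real) \<Rightarrow> bool" where
  "C_k_function A k N F \<longleftrightarrow>
     (\<forall>c\<in>A. C_k_on k (snd c ` (fst c \<inter> N)) (F \<circ> chart_inv c))"

definition C_k_curve ::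
  "'m topology \<Rightarrow> ('m, 'n::finite) chart set \<Rightarrow> nat \<Rightarrow> real set \<Rightarrow> (real \<Rightarrow> 'm) \<Rightarrow> bool" where
  "C_k_curve M A k S g \<longleftrightarrow> continuous_map (top_of_set S) M g \<and>
     (\<forall>c\<in>A. C_k_on k {s \<in> S. g s \<in> fst c} (\<lambda>s. snd c (g s)))"


section \<open>Tangent vectors, vector fields and differentials\<close>

text \<open>
  A tangent vector at \<open>p\<close> is the family of its coordinate vectors in the charts around \<open>p\<close>,
  related by the derivatives of the transition maps. Coordinates in all other charts are set to
  zero, so that a tangent vector is determined by its coordinates in a single chart around \<open>p\<close>.
\<close>

type_synonym ('m, 'n) tangent_vector = "('m, 'n) chart \<Rightarrow> real ^ 'n"

definition tangent_space ::
  "('m, 'n::finite) chart set \<Rightarrow> 'm \<Rightarrow> ('m, 'n) tangent_vector set" where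
  "tangent_space A p = {v.
     (\<forall>c. c \<notin> A \<or> p \<notin> fst c \<longrightarrow> v c = 0) \<and>
     (\<forall>c\<in>A. \<forall>c'\<in>A. p \<in> fst c \<inter> fst c' \<longrightarrow>
        v c' = frechet_derivative (transition c c') (at (snd c p)) (v c))}"

definition vector_field ::
  "'m topology \<Rightarrow> ('m, 'n::finite) chart set \<Rightarrow> ('m \<Rightarrow> ('m, 'n) tangent_vector) \<Rightarrow> bool" where
  "vector_field M A X \<longleftrightarrow> (\<forall>p\<in>topspace M. X p \<in> tangent_space A p)"

text \<open>Joint \<open>C\<^sup>k\<close> dependence of \<open>X\<^sub>\<epsilon>(x)\<close> on the point \<open>x\<close> and the parameter \<open>\<epsilon> \<in> E\<close>.\<close>

definition C_k_vector_field_family ::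
  "'m topology \<Rightarrow> ('m, 'n::finite) chart set \<Rightarrow> nat \<Rightarrow> real set \<Rightarrow>
    (real \<Rightarrow> 'm \<Rightarrow> ('m, 'n) tangent_vector) \<Rightarrow> bool" where
  "C_k_vector_field_family M A k E X \<longleftrightarrow> (\<forall>\<epsilon>\<in>E. vector_field M A (X \<epsilon>)) \<and>
     (\<forall>c\<in>A. C_k_on k (snd c ` fst c \<times> E) (\<lambda>(x, \<epsilon>). X \<epsilon> (chart_inv c x) c))"

text \<open>
  The differential \<open>dF\<^sub>p(v)\<close>, computed in some chart around \<open>p\<close>; by the chain rule and the
  compatibility condition on \<open>v\<close> the result does not depend on this chart.
\<close>

definition differential ::
  "('m, 'n::finite) chart set \<Rightarrow> ('m \<Rightarrow> real) \<Rightarrow> 'm \<Rightarrow> ('m, 'n) tangent_vector \<Rightarrow> real" where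
  "differential A F p v =
     (let c = (SOME c. c \<in> A \<and> p \<in> fst c)
      in frechet_derivative (F \<circ> chart_inv c) (at (snd c p)) (v c))"


section \<open>Periodic orbits and first integrals\<close>

definition integral_curve ::
  "'m topology \<Rightarrow> ('m, 'n::finite) chart set \<Rightarrow> ('m \<Rightarrow> ('m, 'n) tangent_vector) \<Rightarrow>
    (real \<Rightarrow> 'm) \<Rightarrow> bool" where
  "integral_curve M A X \<gamma> \<longleftrightarrow> continuous_map euclidean M \<gamma> \<and>
     (\<forall>t. \<forall>c\<in>A. \<gamma> t \<in> fst c \<longrightarrow>
        ((\<lambda>s. snd c (\<gamma> s)) has_vector_derivative X (\<gamma> t) c) (at t))"

text \<open>The period \<open>T\<close> is not required to be minimal.\<close>

definition periodic_orbit ::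
  "'m topology \<Rightarrow> ('m, 'n::finite) chart set \<Rightarrow> ('m \<Rightarrow> ('m, 'n) tangent_vector) \<Rightarrow>
    real \<Rightarrow> (real \<Rightarrow> 'm) \<Rightarrow> bool" where
  "periodic_orbit M A X T \<gamma> \<longleftrightarrow>
     T > 0 \<and> integral_curve M A X \<gamma> \<and> (\<forall>t. \<gamma> (t + T) = \<gamma> t)"

definition first_integral ::
  "('m, 'n::finite) chart set \<Rightarrow> nat \<Rightarrow> 'm set \<Rightarrow> ('m \<Rightarrow> ('m, 'n) tangent_vector) \<Rightarrow>
    ('m \<Rightarrow> real) \<Rightarrow> bool" where
  "first_integral A k N X F \<longleftrightarrow> C_k_function A k N F \<and> \<not> F constant_on N \<and>
     (\<forall>p\<in>N. differential A F p (X p) = 0)"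

end

theory Submission
  imports Defs
begin

text \<open>
  Along a perturbed orbit the first integral changes at the rate
  \<open>(d/dt) F(\<gamma>\<^sub>\<epsilon>(t)) = dF(X\<^sub>\<epsilon>)(\<gamma>\<^sub>\<epsilon>(t))\<close>. Since \<open>dF(X\<^sup>0) = 0\<close> near \<open>\<Gamma>\<close>, this rate is
  \<open>\<epsilon> dF(X\<^sup>1)(\<gamma>(t)) + o(\<epsilon>)\<close>. The perturbed orbit closes after the time \<open>T\<^sub>\<epsilon>\<close>, so the total change of \<open>F\<close> over
  \<open>[0, T\<^sub>\<epsilon>]\<close> is zero for every \<open>\<epsilon>\<close>; dividing by \<open>\<epsilon>\<close> and letting \<open>\<epsilon> \<rightarrow> 0\<close> gives the claim.

  The smoothness hypothesis on the orbits concerns each \<open>\<epsilon> \<mapsto> \<gamma>\<^sub>\<epsilon>(t)\<close> with \<open>t\<close> fixed, whereas the error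
  term \<open>o(\<epsilon>)\<close> must be uniform in \<open>t\<close>. Uniformity comes from a bound on the speed:
  the vector fields \<open>X\<^sub>\<epsilon>\<close> are bounded in a coordinate ball around \<open>\<gamma>(t\<^sub>0)\<close>, uniformly in small
  \<open>\<epsilon>\<close>, so a perturbed orbit that starts close to \<open>\<gamma>(t\<^sub>0)\<close> at time \<open>t\<^sub>0\<close> cannot leave the ball during a short time
  interval that does not depend on \<open>\<epsilon>\<close> (\<open>slow_curve_stays_in_chart_ball\<close>). In that ball the estimate
  of the rate is a continuity statement about functions of the coordinates and of \<open>\<epsilon>\<close>
  (\<open>first_variation_along_level_sets\<close>). Both are combined in
  \<open>first_integral_rate_near_orbit_point\<close>, and compactness of the time interval turns the local
  estimates into the averaged statement (\<open>zero_mean_rate_of_closed_orbits\<close>).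
\<close>

section \<open>Functions of class \<open>C\<^sup>k\<close>\<close>

lemma C_k_on_imp_continuous_on: "C_k_on k S f \<Longrightarrow> continuous_on S f"
  by (cases k) (auto simp: differentiable_imp_continuous_on)

lemma C_k_on_derivative:
  assumes "C_k_on k S f" "k \<ge> 1"
  shows "x \<in> S \<Longrightarrow> (f has_derivative frechet_derivative f (at x within S)) (at x within S)"
    and "continuous_on S (\<lambda>x. frechet_derivative f (at x within S) v)"
proof -
  obtain m where k: "k = Suc m"
    using assms(2) by (cases k) auto
  show "x \<in> S \<Longrightarrow> (f has_derivative frechet_derivative f (at x within S)) (at x within S)"
    using assms(1) by (auto simp: k differentiable_on_def frechet_derivative_works)
  show "continuous_on S (\<lambda>x. frechet_derivative f (at x within S) v)"
    using assms(1) by (auto simp: k intro: C_k_on_imp_continuous_on)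
qed

lemma C_k_on_open_derivative:
  assumes "C_k_on k U f" "k \<ge> 1" "open U"
  shows "x \<in> U \<Longrightarrow> (f has_derivative frechet_derivative f (at x)) (at x)"
    and "continuous_on U (\<lambda>x. frechet_derivative f (at x) v)"
proof -
  show "x \<in> U \<Longrightarrow> (f has_derivative frechet_derivative f (at x)) (at x)"
    using C_k_on_derivative(1)[OF assms(1,2)] assms(3) by (metis at_within_open)
  show "continuous_on U (\<lambda>x. frechet_derivative f (at x) v)"
    using C_k_on_derivative(2)[OF assms(1,2), of v]
    by (rule continuous_on_eq) (metis assms(3) at_within_open)
qed

text \<open>
  \<open>C_k_on\<close> controls the derivative only in one fixed direction at a time. In finite
  dimension an expansion in a basis gives continuity jointly in the point and the direction.
\<close>

lemma continuous_on_derivative_pairing: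
  fixes \<Phi> :: "'a::euclidean_space \<Rightarrow> real"
  assumes "C_k_on k U \<Phi>" "k \<ge> 1" "open U"
    and "continuous_on S y" "continuous_on S w" "y ` S \<subseteq> U"
  shows "continuous_on S (\<lambda>s. frechet_derivative \<Phi> (at (y s)) (w s))"
proof -
  have "frechet_derivative \<Phi> (at (y s)) (w s) =
      (\<Sum>b\<in>Basis. (w s \<bullet> b) * frechet_derivative \<Phi> (at (y s)) b)" if "s \<in> S" for s
  proof -
    interpret bounded_linear "frechet_derivative \<Phi> (at (y s))"
      using C_k_on_open_derivative(1)[OF assms(1-3)] assms(6) that
      by (blast intro: has_derivative_bounded_linear)
    have "frechet_derivative \<Phi> (at (y s)) (w s) =
        frechet_derivative \<Phi> (at (y s)) (\<Sum>b\<in>Basis. (w s \<bullet> b) *\<^sub>R b)"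
      by (simp add: euclidean_representation)
    then show ?thesis
      by (simp add: sum scaleR)
  qed
  moreover have "continuous_on S (\<lambda>s. \<Sum>b\<in>Basis. (w s \<bullet> b) * frechet_derivative \<Phi> (at (y s)) b)"
    using continuous_on_compose2[OF C_k_on_open_derivative(2)[OF assms(1-3)] assms(4,6)] assms(5)
    by (intro continuous_intros) auto
  ultimately show ?thesis
    by (simp cong: continuous_on_cong)
qed

lemma partial_derivative_of_C_k_family:
  assumes "C_k_on k (V \<times> E) f" "k \<ge> 1" "x \<in> V" "\<epsilon> \<in> E"
  shows "((\<lambda>\<epsilon>. f (x, \<epsilon>)) has_vector_derivative
      frechet_derivative f (at (x, \<epsilon>) within V \<times> E) (0, 1)) (at \<epsilon> within E)"
proof -
  let ?D = "frechet_derivative f (at (x, \<epsilon>) within V \<times> E)"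
  have D: "(f has_derivative ?D) (at (x, \<epsilon>) within V \<times> E)"
    using assms(3,4) by (intro C_k_on_derivative(1)[OF assms(1,2)]) simp
  have "((\<lambda>\<epsilon>. (x, \<epsilon>)) has_derivative (\<lambda>s. (0, s))) (at \<epsilon> within E)"
    by (intro has_derivative_Pair has_derivative_const has_derivative_ident)
  moreover have "(f has_derivative ?D) (at (x, \<epsilon>) within (\<lambda>\<epsilon>. (x, \<epsilon>)) ` E)"
    using assms(3) by (intro has_derivative_subset[OF D]) auto
  ultimately have "((\<lambda>\<epsilon>. f (x, \<epsilon>)) has_derivative (\<lambda>s. ?D (0, s))) (at \<epsilon> within E)"
    by (rule has_derivative_in_compose)
  moreover have "(\<lambda>s. ?D (0, s)) = (\<lambda>s. s *\<^sub>R ?D (0, 1))"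
  proof
    fix s :: real
    show "?D (0, s) = s *\<^sub>R ?D (0, 1)"
      using linear_scale[OF has_derivative_linear[OF D], of s "(0, 1)"] by simp
  qed
  ultimately show ?thesis
    unfolding has_vector_derivative_def by (rule back_subst)
qed

section \<open>The first variation of a conserved quantity in coordinates\<close>

lemma at_within_half_open_interval:
  assumes "a < (b :: real)"
  shows "at a within {a..<b} = at_right a"
  using assms by (intro at_within_nhd[where S = "{..<b}"]) auto

text \<open>
  For fixed \<open>y\<close>, the function \<open>\<epsilon> \<mapsto> D\<Phi>(y)(f(y, \<epsilon>))\<close> vanishes at \<open>\<epsilon> = 0\<close>, so by the mean value
  theorem its value is \<open>\<epsilon> D\<Phi>(y)(\<partial>\<^sub>\<epsilon>f(y, \<xi>))\<close> with \<open>\<xi>\<close> between \<open>0\<close> and \<open>\<epsilon>\<close>. The second factor is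
  continuous in \<open>(y, \<xi>)\<close> and equals \<open>D\<Phi>(x)(v)\<close> at \<open>(x, 0)\<close>.
\<close>

lemma first_variation_along_level_sets:
  fixes f :: "'a::euclidean_space \<times> real \<Rightarrow> 'a" and \<Phi> :: "'a \<Rightarrow> real"
  assumes \<Phi>: "C_k_on k U \<Phi>" "k \<ge> 1" and U: "open U" "U \<subseteq> V" "x \<in> U"
    and f: "C_k_on m (V \<times> {0..<\<epsilon>\<^sub>0}) f" "m \<ge> 1" and "\<epsilon>\<^sub>0 > 0"
    and conserved: "\<And>y. y \<in> U \<Longrightarrow> frechet_derivative \<Phi> (at y) (f (y, 0)) = 0"
    and v: "((\<lambda>\<epsilon>. f (x, \<epsilon>)) has_vector_derivative v) (at_right 0)"
    and "\<eta> > 0"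
  shows "\<exists>\<rho>>0. \<forall>y\<in>cball x \<rho>. \<forall>\<epsilon>\<in>{0<..<\<rho>}.
    \<bar>frechet_derivative \<Phi> (at y) (f (y, \<epsilon>)) - \<epsilon> * frechet_derivative \<Phi> (at x) v\<bar> \<le> \<eta> * \<epsilon>"
proof -
  define E where "E = {0..<\<epsilon>\<^sub>0}"
  note f = f[folded E_def]
  define g where "g z = frechet_derivative f (at z within V \<times> E) (0, 1)" for z
  define q where "q z = frechet_derivative \<Phi> (at (fst z)) (g z)" for z
  have "0 \<in> E"
    using \<open>\<epsilon>\<^sub>0 > 0\<close> by (simp add: E_def)
  have g: "((\<lambda>\<epsilon>. f (y, \<epsilon>)) has_vector_derivative g (y, \<epsilon>)) (at \<epsilon> within E)"
    if "y \<in> U" "\<epsilon> \<in> E" for y \<epsilon>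
    using partial_derivative_of_C_k_family[OF f] that U(2) unfolding g_def by blast
  have "((\<lambda>\<epsilon>. f (x, \<epsilon>)) has_vector_derivative g (x, 0)) (at_right 0)"
  proof -
    have "at 0 within E = at_right (0::real)"
      unfolding E_def using \<open>\<epsilon>\<^sub>0 > 0\<close>
      by (rule at_within_half_open_interval)
    then show ?thesis
      using g[OF U(3) \<open>0 \<in> E\<close>] by simp
  qed
  then have "g (x, 0) = v"
    using v vector_derivative_unique_within trivial_limit_at_right_real by blast
  have "continuous_on (U \<times> E) g"
    unfolding g_def using U(2)
    by (intro continuous_on_subset[OF C_k_on_derivative(2)[OF f]]) auto
  then have "continuous_on (U \<times> E) q"
    unfolding q_def using U(1)
    by (intro continuous_on_derivative_pairing[OF \<Phi>] continuous_intros) auto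
  moreover have "(x, 0) \<in> U \<times> E"
    using U(3) \<open>0 \<in> E\<close> by simp
  ultimately obtain d where "d > 0"
    and d: "\<And>z. z \<in> U \<times> E \<Longrightarrow> dist z (x, 0) < d \<Longrightarrow> dist (q z) (q (x, 0)) < \<eta>"
    using \<open>\<eta> > 0\<close> unfolding continuous_on_iff by blast
  obtain r where "r > 0" and r: "cball x r \<subseteq> U"
    using U(1,3) open_contains_cball by blast
  \<comment> \<open>The two coordinates of \<open>(y, \<xi>)\<close> deviate from \<open>(x, 0)\<close> by at most \<open>d / 3\<close> each.\<close>
  define \<rho> where "\<rho> = min (min r (d / 3)) \<epsilon>\<^sub>0"
  have "\<bar>frechet_derivative \<Phi> (at y) (f (y, \<epsilon>)) - \<epsilon> * frechet_derivative \<Phi> (at x) v\<bar> \<le> \<eta> * \<epsilon>"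
    if y: "y \<in> cball x \<rho>" and \<epsilon>: "\<epsilon> \<in> {0<..<\<rho>}" for y \<epsilon>
  proof -
    have "y \<in> U" "dist y x \<le> d / 3"
      using y r by (auto simp: \<rho>_def dist_commute)
    have sub: "{0..\<epsilon>} \<subseteq> E"
      using \<epsilon> by (auto simp: \<rho>_def E_def)
    interpret bounded_linear "frechet_derivative \<Phi> (at y)"
      using C_k_on_open_derivative(1)[OF \<Phi> U(1)] \<open>y \<in> U\<close> has_derivative_bounded_linear by blast
    have "((\<lambda>\<epsilon>. frechet_derivative \<Phi> (at y) (f (y, \<epsilon>))) has_derivative (\<lambda>s. s * q (y, \<xi>)))
        (at \<xi> within {0..\<epsilon>})" if "0 \<le> \<xi>" "\<xi> \<le> \<epsilon>" for \<xi>
      using has_derivative[OF has_derivative_subset[OF g[OF \<open>y \<in> U\<close>, unfolded has_vector_derivative_def] sub]]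
        that sub by (auto simp: scaleR q_def)
    then obtain \<xi> where \<xi>: "\<xi> \<in> {0<..<\<epsilon>}"
      "frechet_derivative \<Phi> (at y) (f (y, \<epsilon>)) - frechet_derivative \<Phi> (at y) (f (y, 0)) = (\<epsilon> - 0) * q (y, \<xi>)"
      using mvt_simple[of 0 \<epsilon> "\<lambda>\<epsilon>. frechet_derivative \<Phi> (at y) (f (y, \<epsilon>))" "\<lambda>\<xi> s. s * q (y, \<xi>)"] \<epsilon> by auto
    have "dist (y, \<xi>) (x, 0) \<le> dist y x + dist \<xi> 0"
      using sqrt_sum_squares_le_sum_abs[of "dist y x" "dist \<xi> 0"] by (simp add: dist_Pair_Pair)
    also have "\<dots> < d"
      using \<open>dist y x \<le> d / 3\<close> \<xi>(1) \<epsilon> \<open>d > 0\<close> by (auto simp: \<rho>_def)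
    finally have "\<bar>q (y, \<xi>) - q (x, 0)\<bar> < \<eta>"
      using d[of "(y, \<xi>)"] \<open>y \<in> U\<close> \<xi>(1) subsetD[OF sub, of \<xi>] by (simp add: dist_real_def)
    then have "\<bar>\<epsilon> * (q (y, \<xi>) - q (x, 0))\<bar> \<le> \<epsilon> * \<eta>"
      using \<epsilon> by (simp add: abs_mult)
    moreover have "q (x, 0) = frechet_derivative \<Phi> (at x) v"
      using \<open>g (x, 0) = v\<close> by (simp add: q_def)
    ultimately show ?thesis
      using \<xi>(2) conserved[OF \<open>y \<in> U\<close>] \<epsilon> by (simp add: algebra_simps)
  qed
  moreover have "\<rho> > 0"
    using \<open>r > 0\<close> \<open>d > 0\<close> \<open>\<epsilon>\<^sub>0 > 0\<close> by (simp add: \<rho>_def)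
  ultimately show ?thesis
    by blast
qed

text \<open>
  The expansion hypothesis identifies the zeroth and the first order coefficient of \<open>\<epsilon> \<mapsto> X\<^sub>\<epsilon>(p)\<close> at \<open>0\<close>,
  given that this function is continuous there.
\<close>

lemma has_vector_derivative_of_quadratic_expansion:
  fixes g :: "real \<Rightarrow> 'a::real_normed_vector"
  assumes "(g \<longlongrightarrow> g 0) (at_right 0)"
    and "(\<lambda>\<epsilon>. norm (g \<epsilon> - (a + \<epsilon> *\<^sub>R b))) \<in> O[at_right 0](\<lambda>\<epsilon>. \<epsilon>\<^sup>2)"
  shows "g 0 = a" "(g has_vector_derivative b) (at_right 0)"
proof -
  obtain C where C: "\<forall>\<^sub>F \<epsilon> in at_right 0. norm (g \<epsilon> - (a + \<epsilon> *\<^sub>R b)) \<le> C * \<epsilon>\<^sup>2"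
    using assms(2) by (auto elim!: landau_o.bigE)
  have sq: "((\<lambda>\<epsilon>. C * \<epsilon>\<^sup>2) \<longlongrightarrow> C * 0\<^sup>2) (at_right 0)"
    by (intro tendsto_intros)
  have "((\<lambda>\<epsilon>. g \<epsilon> - (a + \<epsilon> *\<^sub>R b)) \<longlongrightarrow> 0) (at_right 0)"
    using Lim_null_comparison[OF C] sq by simp
  moreover have "((\<lambda>\<epsilon>. a + \<epsilon> *\<^sub>R b) \<longlongrightarrow> a + 0 *\<^sub>R b) (at_right 0)"
    by (intro tendsto_intros)
  ultimately have "((\<lambda>\<epsilon>. (g \<epsilon> - (a + \<epsilon> *\<^sub>R b)) + (a + \<epsilon> *\<^sub>R b)) \<longlongrightarrow> 0 + (a + 0 *\<^sub>R b)) (at_right 0)"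
    by (rule tendsto_add)
  then show "g 0 = a"
    using tendsto_unique[OF _ assms(1)] by (simp add: trivial_limit_at_right_real)
  have "\<forall>\<^sub>F \<epsilon> in at_right 0. norm ((1 / norm (\<epsilon> - 0)) *\<^sub>R (g \<epsilon> - (g 0 + (\<epsilon> - 0) *\<^sub>R b))) \<le> C * \<epsilon>"
    using C eventually_at_right_less[of 0]
  proof eventually_elim
    case (elim \<epsilon>)
    then show ?case
      using \<open>g 0 = a\<close> by (simp add: divide_simps power2_eq_square mult.assoc)
  qed
  moreover have "((\<lambda>\<epsilon>. C * \<epsilon>) \<longlongrightarrow> 0) (at_right 0)"
    by (intro tendsto_mult_right_zero tendsto_ident_at)
  ultimately have "((\<lambda>\<epsilon>. (1 / norm (\<epsilon> - 0)) *\<^sub>R (g \<epsilon> - (g 0 + (\<epsilon> - 0) *\<^sub>R b))) \<longlongrightarrow> 0) (at_right 0)"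
    by (rule Lim_null_comparison)
  then show "(g has_vector_derivative b) (at_right 0)"
    unfolding has_vector_derivative_def has_derivative_within
    by (simp add: bounded_linear_scaleR_left)
qed

section \<open>Charts\<close>

lemma chart_inv_facts:
  assumes "is_chart M c"
  shows "inj_on (snd c) (fst c)" "fst c \<subseteq> topspace M"
    and "p \<in> fst c \<Longrightarrow> chart_inv c (snd c p) = p"
proof -
  show sub: "fst c \<subseteq> topspace M"
    using assms openin_subset unfolding is_chart_def by blast
  show inj: "inj_on (snd c) (fst c)"
    using assms sub homeomorphic_imp_injective_map unfolding is_chart_def
    by (metis topspace_subtopology_subset)
  show "p \<in> fst c \<Longrightarrow> chart_inv c (snd c p) = p"
    using inj by (simp add: chart_inv_def)
qed

lemma open_chart_image:
  assumes "is_chart M c" "openin M N"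
  shows "open (snd c ` (fst c \<inter> N))"
proof -
  have "openin (subtopology M (fst c)) (fst c \<inter> N)"
    using assms(2) by (rule openin_subtopology_Int2)
  then have "openin (top_of_set (snd c ` fst c)) (snd c ` (fst c \<inter> N))"
    using assms(1) homeomorphic_imp_open_map unfolding is_chart_def open_map_def by blast
  then show ?thesis
    using assms(1) openin_open_trans unfolding is_chart_def by blast
qed

lemma openin_chart_preimage:
  assumes "is_chart M c" "open Q"
  shows "openin M {q \<in> fst c. snd c q \<in> Q}"
proof -
  have cont: "continuous_map (subtopology M (fst c)) (top_of_set (snd c ` fst c)) (snd c)"
    using assms(1) homeomorphic_imp_continuous_map unfolding is_chart_def by blast
  have "openin (subtopology M (fst c)) {q \<in> topspace (subtopology M (fst c)). snd c q \<in> snd c ` fst c \<inter> Q}"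
    using cont openin_open_Int[OF assms(2)] by (rule openin_continuous_map_preimage)
  moreover have "{q \<in> topspace (subtopology M (fst c)). snd c q \<in> snd c ` fst c \<inter> Q} = {q \<in> fst c. snd c q \<in> Q}"
    using chart_inv_facts(2)[OF assms(1)] by auto
  ultimately show ?thesis
    using assms(1) openin_trans_full unfolding is_chart_def by fastforce
qed

text \<open>
  A coordinate ball is compact, hence closed in the whole manifold: here the Hausdorff property enters.
\<close>

lemma closedin_chart_ball:
  assumes "Hausdorff_space M" "is_chart M c" "cball x r \<subseteq> snd c ` fst c"
  shows "closedin M {q \<in> fst c. snd c q \<in> cball x r}"
proof -
  let ?K = "{q \<in> fst c. snd c q \<in> cball x r}"
  have K: "?K \<subseteq> topspace (subtopology M (fst c))" "snd c ` ?K = cball x r"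
    using chart_inv_facts(2)[OF assms(2)] assms(3) by auto
  have "compactin (top_of_set (snd c ` fst c)) (snd c ` ?K)"
    unfolding K(2) using assms(3) by (simp add: compactin_subtopology)
  then have "compactin (subtopology M (fst c)) ?K"
    using assms(2) homeomorphic_map_compactness K(1) unfolding is_chart_def by blast
  then show ?thesis
    using assms(1) compactin_imp_closedin compactin_subtopology by blast
qed

text \<open>
  Justifies computing \<open>dF\<close> in a chart of choice: the definition picks an arbitrary chart around
  each point, and this choice may jump along a curve.
\<close>

lemma differential_in_chart:
  fixes M :: "'m topology" and A :: "('m, 'n::finite) chart set"
  assumes manifold: "oriented_manifold m M A" "m \<ge> 1"
    and N: "openin M N" and F: "C_k_function A k N F" "k \<ge> 1"
    and p: "p \<in> N" "c \<in> A" "p \<in> fst c" and v: "v \<in> tangent_space A p"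
  shows "differential A F p v = frechet_derivative (F \<circ> chart_inv c) (at (snd c p)) (v c)"
proof -
  define c' where "c' = (SOME c. c \<in> A \<and> p \<in> fst c)"
  have c': "c' \<in> A" "p \<in> fst c'"
    using someI[of "\<lambda>c. c \<in> A \<and> p \<in> fst c"] p by (auto simp: c'_def)
  have chart: "is_chart M c" "is_chart M c'"
    using manifold p(2) c'(1) by (auto simp: oriented_manifold_def)
  define Q where "Q = snd c ` (fst c \<inter> (fst c' \<inter> N))"
  have "openin M (fst c')"
    using chart(2) by (simp add: is_chart_def)
  then have "open Q"
    unfolding Q_def using chart(1) N by (intro open_chart_image openin_Int)
  have x: "snd c p \<in> Q"
    using p c'(2) by (auto simp: Q_def)
  have "open (snd c ` (fst c \<inter> fst c'))"
    using chart(1) \<open>openin M (fst c')\<close> by (rule open_chart_image)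
  moreover have "C_k_on m (snd c ` (fst c \<inter> fst c')) (transition c c')"
    using manifold(1) p(2) c'(1) by (simp add: oriented_manifold_def)
  ultimately have trans: "(transition c c' has_derivative
      frechet_derivative (transition c c') (at (snd c p))) (at (snd c p))"
    using manifold(2) p(3) c'(2) by (intro C_k_on_open_derivative(1)) auto
  have "open (snd c' ` (fst c' \<inter> N))"
    using chart(2) N by (rule open_chart_image)
  moreover have "C_k_on k (snd c' ` (fst c' \<inter> N)) (F \<circ> chart_inv c')"
    using F(1) c'(1) by (simp add: C_k_function_def)
  moreover have "transition c c' (snd c p) = snd c' p"
    using chart_inv_facts(3)[OF chart(1) p(3)] by (simp add: transition_def)
  ultimately have F': "(F \<circ> chart_inv c' has_derivative
      frechet_derivative (F \<circ> chart_inv c') (at (snd c' p))) (at (transition c c' (snd c p)))"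
    using F(2) p(1) c'(2) by (auto intro: C_k_on_open_derivative(1))
  have "(F \<circ> chart_inv c has_derivative frechet_derivative (F \<circ> chart_inv c') (at (snd c' p)) \<circ>
      frechet_derivative (transition c c') (at (snd c p))) (at (snd c p))"
  proof (rule has_derivative_transform_within_open[OF diff_chain_at[OF trans F'] \<open>open Q\<close> x])
    fix y assume "y \<in> Q"
    then obtain q where q: "q \<in> fst c" "q \<in> fst c'" "y = snd c q"
      by (auto simp: Q_def)
    then show "((F \<circ> chart_inv c') \<circ> transition c c') y = (F \<circ> chart_inv c) y"
      using chart_inv_facts(3)[OF chart(1)] chart_inv_facts(3)[OF chart(2)]
      by (simp add: transition_def)
  qed
  then have "frechet_derivative (F \<circ> chart_inv c) (at (snd c p)) =
      frechet_derivative (F \<circ> chart_inv c') (at (snd c' p)) \<circ>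
      frechet_derivative (transition c c') (at (snd c p))"
    using frechet_derivative_at by metis
  moreover have "v c' = frechet_derivative (transition c c') (at (snd c p)) (v c)"
    using v p c' unfolding tangent_space_def by blast
  ultimately show ?thesis
    unfolding differential_def Let_def c'_def[symmetric] by simp
qed

section \<open>Confinement of slow curves\<close>

text \<open>
  A curve that starts in the ball of radius \<open>r\<close> with speed at most \<open>B\<close> stays in the ball of radius
  \<open>r + B \<delta> < 2 * r\<close> for as long as it is known to stay in the chart ball of radius \<open>2 * r\<close>. At
  an exit time nearest to \<open>t\<^sub>0\<close>, closedness of the smaller ball in \<open>M\<close> would put the curve inside the larger
  one. The argument runs forwards and backwards in time at once.
\<close>

lemma slow_curve_stays_in_chart_ball:
  fixes M :: "'m topology" and c :: "('m, 'n::finite) chart"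
  assumes M: "Hausdorff_space M" "is_chart M c" and ball: "cball x (2 * r) \<subseteq> snd c ` fst c"
    and \<phi>: "continuous_map euclidean M \<phi>"
    and start: "\<phi> t\<^sub>0 \<in> fst c" "snd c (\<phi> t\<^sub>0) \<in> cball x r"
    and velocity: "\<And>t. \<phi> t \<in> fst c \<Longrightarrow> ((\<lambda>s. snd c (\<phi> s)) has_vector_derivative w t) (at t)"
    and speed: "\<And>t. \<phi> t \<in> fst c \<Longrightarrow> snd c (\<phi> t) \<in> cball x (2 * r) \<Longrightarrow> norm (w t) \<le> B"
    and \<delta>: "B * \<delta> < r" "B \<ge> 0" "t \<in> cball t\<^sub>0 \<delta>"
  shows "\<phi> t \<in> fst c" "snd c (\<phi> t) \<in> cball x (2 * r)"
proof -
  define W where "W = {q \<in> fst c. snd c q \<in> ball x (2 * r)}"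
  define K where "K = {q \<in> fst c. snd c q \<in> cball x (r + B * \<delta>)}"
  have "0 \<le> \<delta>"
    using \<delta>(3) zero_le_dist[of t\<^sub>0 t] by (simp del: zero_le_dist)
  have "K \<subseteq> W"
    using \<delta>(1) by (auto simp: K_def W_def)
  have "cball x (r + B * \<delta>) \<subseteq> snd c ` fst c"
    using ball \<delta>(1) by (intro subset_trans[OF subset_cball ball]) simp
  then have "closedin M K"
    unfolding K_def using M by (intro closedin_chart_ball)
  then have "closed {t. \<phi> t \<in> K}"
    using closedin_continuous_map_preimage[OF \<phi>] by simp
  have "openin M W"
    unfolding W_def using M by (intro openin_chart_preimage) auto
  then have "open {t. \<phi> t \<in> W}"
    using openin_continuous_map_preimage[OF \<phi>] by simp
  have "0 \<le> B * \<delta>"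
    using \<delta>(2) \<open>0 \<le> \<delta>\<close> by simp
  then have "\<phi> t\<^sub>0 \<in> W"
    using start \<open>K \<subseteq> W\<close> by (auto simp: K_def)
  have near_start: "\<phi> s \<in> K" if s: "s \<in> cball t\<^sub>0 \<delta>" "\<phi> ` closed_segment t\<^sub>0 s \<subseteq> W" for s
  proof -
    have "norm (snd c (\<phi> s) - snd c (\<phi> t\<^sub>0)) \<le> B * norm (s - t\<^sub>0)"
    proof (rule differentiable_bound[where S = "closed_segment t\<^sub>0 s" and f' = "\<lambda>u h. h *\<^sub>R w u"])
      fix u assume "u \<in> closed_segment t\<^sub>0 s"
      then have "\<phi> u \<in> W" using s(2) by blast
      then have *: "((\<lambda>s. snd c (\<phi> s)) has_vector_derivative w u) (at u)" "norm (w u) \<le> B"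
        using velocity[of u] speed[of u] by (auto simp: W_def)
      show "((\<lambda>s. snd c (\<phi> s)) has_derivative (\<lambda>h. h *\<^sub>R w u)) (at u within closed_segment t\<^sub>0 s)"
        using *(1) has_derivative_at_withinI unfolding has_vector_derivative_def by blast
      show "onorm (\<lambda>h. h *\<^sub>R w u) \<le> B"
      proof (rule onorm_le)
        fix h :: real
        show "norm (h *\<^sub>R w u) \<le> B * norm h"
          using mult_right_mono[OF *(2), of "\<bar>h\<bar>"] by (simp add: mult.commute)
      qed
    qed auto
    also have "\<dots> \<le> B * \<delta>"
      using s(1) \<delta>(2) by (intro mult_left_mono) (simp_all add: dist_real_def abs_minus_commute)
    finally have "dist x (snd c (\<phi> s)) \<le> r + B * \<delta>"
      using start(2) dist_triangle[of x "snd c (\<phi> s)" "snd c (\<phi> t\<^sub>0)"]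
      by (simp add: dist_norm norm_minus_commute)
    moreover have "\<phi> s \<in> fst c"
      using s(2) by (auto simp: W_def)
    ultimately show ?thesis
      by (simp add: K_def)
  qed
  have "\<phi> s \<in> W" if "s \<in> cball t\<^sub>0 \<delta>" for s
  proof (rule ccontr)
    assume "\<phi> s \<notin> W"
    let ?Z = "cball t\<^sub>0 \<delta> - {t. \<phi> t \<in> W}"
    have "closed ?Z" "?Z \<noteq> {}"
      using \<open>open {t. \<phi> t \<in> W}\<close> that \<open>\<phi> s \<notin> W\<close> by auto
    then obtain u where u: "u \<in> ?Z" "\<And>y. y \<in> ?Z \<Longrightarrow> dist t\<^sub>0 u \<le> dist t\<^sub>0 y"
      using distance_attains_inf by metis
    have "u \<noteq> t\<^sub>0"
      using u(1) \<open>\<phi> t\<^sub>0 \<in> W\<close> by auto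
    have inW: "\<phi> y \<in> W" if "y \<in> open_segment t\<^sub>0 u" for y
    proof (rule ccontr)
      assume "\<phi> y \<notin> W"
      have "dist t\<^sub>0 y < dist t\<^sub>0 u"
        using dist_in_open_segment[OF that] by (simp add: dist_commute)
      then show False
        using u(1) u(2)[of y] \<open>\<phi> y \<notin> W\<close> by auto
    qed
    have "\<phi> y \<in> K" if y: "y \<in> open_segment t\<^sub>0 u" for y
    proof (rule near_start)
      show "y \<in> cball t\<^sub>0 \<delta>"
        using dist_in_open_segment[OF y] u(1) by (simp add: dist_commute)
      have "closed_segment t\<^sub>0 y \<subseteq> insert t\<^sub>0 (open_segment t\<^sub>0 u)"
        using y by (auto simp: open_segment_eq_real_ivl closed_segment_eq_real_ivl split: if_splits)
      then show "\<phi> ` closed_segment t\<^sub>0 y \<subseteq> W"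
        using inW \<open>\<phi> t\<^sub>0 \<in> W\<close> by blast
    qed
    then have "closure (open_segment t\<^sub>0 u) \<subseteq> {t. \<phi> t \<in> K}"
      using \<open>closed {t. \<phi> t \<in> K}\<close> by (intro closure_minimal) auto
    then have "\<phi> u \<in> K"
      using \<open>u \<noteq> t\<^sub>0\<close> by auto
    then show False
      using u(1) \<open>K \<subseteq> W\<close> by auto
  qed
  from this[OF \<delta>(3)] show "\<phi> t \<in> fst c" "snd c (\<phi> t) \<in> cball x (2 * r)"
    by (auto simp: W_def)
qed

section \<open>The rate of change of the first integral along the perturbed orbits\<close>

text \<open>
  In a chart around \<open>p\<close>, choose a ball on which the first variation estimate holds and the speed
  is bounded uniformly in \<open>\<epsilon>\<close>. Convergence at the single time \<open>t\<^sub>0\<close> puts the curves into the half as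
  large ball at that time, and the speed bound keeps them in the ball for \<open>t\<close> near \<open>t\<^sub>0\<close>.
\<close>

lemma first_integral_rate_near_orbit_point:
  fixes M :: "'m topology" and A :: "('m, 'n::finite) chart set"
    and X :: "real \<Rightarrow> 'm \<Rightarrow> ('m, 'n) tangent_vector" and \<gamma> :: "real \<Rightarrow> real \<Rightarrow> 'm"
  assumes manifold: "oriented_manifold m M A" "m \<ge> 1" and "\<epsilon>\<^sub>0 > 0"
    and family: "C_k_vector_field_family M A k {0..<\<epsilon>\<^sub>0} X" "k \<ge> 1"
    and X0: "vector_field M A X0" and X1: "vector_field M A X1"
    and expansion: "\<And>c p. c \<in> A \<Longrightarrow> p \<in> fst c \<Longrightarrow>
      (\<lambda>\<epsilon>. norm (X \<epsilon> p c - (X0 p c + \<epsilon> *\<^sub>R X1 p c))) \<in> O[at_right 0](\<lambda>\<epsilon>. \<epsilon>\<^sup>2)"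
    and N: "openin M N" and F: "first_integral A l N X0 F" "l \<ge> 1"
    and curves: "\<And>\<epsilon>. \<epsilon> \<in> {0..<\<epsilon>\<^sub>0} \<Longrightarrow> integral_curve M A (X \<epsilon>) (\<gamma> \<epsilon>)"
    and lim: "limitin M (\<lambda>\<epsilon>. \<gamma> \<epsilon> t\<^sub>0) p (at_right 0)" and p: "p \<in> N"
    and "\<eta> > 0"
  shows "\<exists>\<delta>>0. \<forall>\<^sub>F \<epsilon> in at_right 0. \<forall>t\<in>cball t\<^sub>0 \<delta>.
    \<exists>d. ((\<lambda>t. F (\<gamma> \<epsilon> t)) has_real_derivative d) (at t) \<and>
      \<bar>d - \<epsilon> * differential A F p (X1 p)\<bar> \<le> \<eta> * \<epsilon>"
proof -
  have "p \<in> topspace M"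
    using p N openin_subset by blast
  then obtain c where c: "c \<in> A" "p \<in> fst c" "is_chart M c"
    using manifold(1) unfolding oriented_manifold_def by blast
  note chart = chart_inv_facts[OF c(3)]
  define x where "x = snd c p"
  define V where "V = snd c ` fst c"
  define U where "U = snd c ` (fst c \<inter> N)"
  define E where "E = {0..<\<epsilon>\<^sub>0}"
  define \<Phi> where "\<Phi> = F \<circ> chart_inv c"
  define f where "f = (\<lambda>(x, \<epsilon>). X \<epsilon> (chart_inv c x) c)"
  have U: "open U" "U \<subseteq> V" "x \<in> U"
    using open_chart_image[OF c(3) N] c(2) p by (auto simp: U_def V_def x_def)
  have "0 \<in> E"
    using \<open>\<epsilon>\<^sub>0 > 0\<close> by (simp add: E_def)
  have \<Phi>: "C_k_on l U \<Phi>"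
    using F(1) c(1) unfolding first_integral_def C_k_function_def U_def \<Phi>_def by blast
  have f: "C_k_on k (V \<times> E) f"
    using family(1) c(1) unfolding C_k_vector_field_family_def V_def f_def E_def by blast
  have f_chart: "f (snd c q, \<epsilon>) = X \<epsilon> q c" if "q \<in> fst c" for q \<epsilon>
    using chart(3)[OF that] by (simp add: f_def)
  have f_expansion: "f (y, 0) = X0 q c" "((\<lambda>\<epsilon>. f (y, \<epsilon>)) has_vector_derivative X1 q c) (at_right 0)"
    if "q \<in> fst c" "y = snd c q" for q y
  proof -
    have "continuous_on E (\<lambda>\<epsilon>. f (y, \<epsilon>))"
      using that by (intro continuous_on_compose2[OF C_k_on_imp_continuous_on[OF f]] continuous_intros)
        (auto simp: V_def)
    then have "((\<lambda>\<epsilon>. f (y, \<epsilon>)) \<longlongrightarrow> f (y, 0)) (at_right 0)"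
      using \<open>0 \<in> E\<close> at_within_half_open_interval[OF \<open>\<epsilon>\<^sub>0 > 0\<close>]
      unfolding continuous_on_def E_def by metis
    then show "f (y, 0) = X0 q c" "((\<lambda>\<epsilon>. f (y, \<epsilon>)) has_vector_derivative X1 q c) (at_right 0)"
      using has_vector_derivative_of_quadratic_expansion[of "\<lambda>\<epsilon>. f (y, \<epsilon>)" "X0 q c" "X1 q c"]
        expansion[OF c(1) that(1)] f_chart[OF that(1)] that(2) by auto
  qed
  have differential: "differential A F q v = frechet_derivative \<Phi> (at (snd c q)) (v c)"
    if "q \<in> fst c" "q \<in> N" "v \<in> tangent_space A q" for q v
    using differential_in_chart[OF manifold N _ F(2) that(2) c(1) that(1,3)] F(1)
    unfolding first_integral_def \<Phi>_def by blast
  have NM: "q \<in> topspace M" if "q \<in> N" for q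
    using that N openin_subset by blast
  have conserved: "frechet_derivative \<Phi> (at y) (f (y, 0)) = 0" if y: "y \<in> U" for y
  proof -
    obtain q where q: "q \<in> fst c" "q \<in> N" "y = snd c q"
      using y by (auto simp: U_def)
    have "X0 q \<in> tangent_space A q"
      using X0 NM[OF q(2)] by (simp add: vector_field_def)
    then have "frechet_derivative \<Phi> (at y) (X0 q c) = differential A F q (X0 q)"
      using differential q by simp
    also have "\<dots> = 0"
      using F(1) q(2) by (simp add: first_integral_def)
    finally show ?thesis
      using f_expansion(1)[OF q(1,3)] by simp
  qed
  have "X1 p \<in> tangent_space A p"
    using X1 NM[OF p] by (simp add: vector_field_def)
  then have rate_p: "differential A F p (X1 p) = frechet_derivative \<Phi> (at x) (X1 p c)"
    using differential[OF c(2) p] by (simp add: x_def)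
  obtain \<rho> where "\<rho> > 0" and \<rho>: "\<And>y \<epsilon>. y \<in> cball x \<rho> \<Longrightarrow> \<epsilon> \<in> {0<..<\<rho>} \<Longrightarrow>
      \<bar>frechet_derivative \<Phi> (at y) (f (y, \<epsilon>)) - \<epsilon> * differential A F p (X1 p)\<bar> \<le> \<eta> * \<epsilon>"
    using first_variation_along_level_sets[OF \<Phi> F(2) U f[unfolded E_def] family(2) \<open>\<epsilon>\<^sub>0 > 0\<close>
        conserved f_expansion(2)[OF c(2) x_def] \<open>\<eta> > 0\<close>] unfolding rate_p by blast
  have "(x, 0) \<in> V \<times> E"
    using U \<open>0 \<in> E\<close> by auto
  then obtain d where "d > 0" and d: "\<And>z. z \<in> V \<times> E \<Longrightarrow> dist z (x, 0) < d \<Longrightarrow> dist (f z) (f (x, 0)) < 1"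
    using C_k_on_imp_continuous_on[OF f] unfolding continuous_on_iff by (metis zero_less_one)
  define B where "B = norm (f (x, 0)) + 1"
  have "B > 0"
    by (simp add: B_def add_nonneg_pos)
  obtain r' where "r' > 0" and r': "cball x r' \<subseteq> U"
    using U(1,3) open_contains_cball by blast
  define r where "r = min r' (min \<rho> (d / 3)) / 2"
  define \<delta> where "\<delta> = r / (2 * B)"
  have "r > 0"
    using \<open>r' > 0\<close> \<open>\<rho> > 0\<close> \<open>d > 0\<close> by (simp add: r_def)
  have r: "cball x (2 * r) \<subseteq> U" "cball x (2 * r) \<subseteq> cball x \<rho>" "2 * r \<le> d / 3"
    using r' by (auto simp: r_def)
  have "\<delta> > 0" "B * \<delta> < r"
    using \<open>r > 0\<close> \<open>B > 0\<close> by (simp_all add: \<delta>_def)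
  have "openin M {q \<in> fst c. snd c q \<in> ball x r}"
    using c(3) by (rule openin_chart_preimage) simp
  moreover have "p \<in> {q \<in> fst c. snd c q \<in> ball x r}"
    using c(2) \<open>r > 0\<close> by (simp add: x_def)
  ultimately have "\<forall>\<^sub>F \<epsilon> in at_right 0. \<gamma> \<epsilon> t\<^sub>0 \<in> {q \<in> fst c. snd c q \<in> ball x r}"
    using lim unfolding limitin_def by blast
  moreover have "\<forall>\<^sub>F \<epsilon> in at_right 0. \<epsilon> \<in> {0<..<min \<epsilon>\<^sub>0 (min \<rho> (d / 3))}"
    using \<open>\<epsilon>\<^sub>0 > 0\<close> \<open>\<rho> > 0\<close> \<open>d > 0\<close> by (intro eventually_at_right_real) simp
  ultimately have "\<forall>\<^sub>F \<epsilon> in at_right 0. \<forall>t\<in>cball t\<^sub>0 \<delta>.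
    \<exists>d. ((\<lambda>t. F (\<gamma> \<epsilon> t)) has_real_derivative d) (at t) \<and>
      \<bar>d - \<epsilon> * differential A F p (X1 p)\<bar> \<le> \<eta> * \<epsilon>"
  proof eventually_elim
    case (elim \<epsilon>)
    then have \<epsilon>: "\<epsilon> \<in> E" "\<epsilon> \<in> {0<..<\<rho>}" "\<bar>\<epsilon>\<bar> < d / 3"
      by (auto simp: E_def)
    have curve: "continuous_map euclidean M (\<gamma> \<epsilon>)"
      using curves[of \<epsilon>] \<epsilon>(1) unfolding integral_curve_def E_def by blast
    have velocity: "((\<lambda>s. snd c (\<gamma> \<epsilon> s)) has_vector_derivative X \<epsilon> (\<gamma> \<epsilon> t) c) (at t)"
      if "\<gamma> \<epsilon> t \<in> fst c" for t
      using curves[of \<epsilon>] \<epsilon>(1) c(1) that unfolding integral_curve_def E_def by blast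
    have speed: "norm (X \<epsilon> (\<gamma> \<epsilon> t) c) \<le> B"
      if t: "\<gamma> \<epsilon> t \<in> fst c" "snd c (\<gamma> \<epsilon> t) \<in> cball x (2 * r)" for t
    proof -
      let ?y = "snd c (\<gamma> \<epsilon> t)"
      have "dist (?y, \<epsilon>) (x, 0) \<le> dist ?y x + \<bar>\<epsilon>\<bar>"
        using sqrt_sum_squares_le_sum_abs[of "dist ?y x" "dist \<epsilon> 0"] by (simp add: dist_Pair_Pair)
      also have "\<dots> < d"
        using t(2) r(3) \<epsilon>(3) \<open>d > 0\<close> by (simp add: dist_commute)
      finally have "dist (f (?y, \<epsilon>)) (f (x, 0)) < 1"
        using t(1) \<epsilon>(1) by (intro d) (auto simp: V_def)
      then show ?thesis
        using norm_triangle_sub[of "f (?y, \<epsilon>)" "f (x, 0)"] f_chart[OF t(1)]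
        by (simp add: B_def dist_norm)
    qed
    show ?case
    proof
      fix t assume t: "t \<in> cball t\<^sub>0 \<delta>"
      have "Hausdorff_space M"
        using manifold(1) by (simp add: oriented_manifold_def)
      have ball: "cball x (2 * r) \<subseteq> snd c ` fst c"
        using r(1) U(2) by (auto simp: V_def)
      have start: "\<gamma> \<epsilon> t\<^sub>0 \<in> fst c" "snd c (\<gamma> \<epsilon> t\<^sub>0) \<in> cball x r"
        using elim(1) by auto
      note stays = slow_curve_stays_in_chart_ball[OF \<open>Hausdorff_space M\<close> c(3) ball curve start
          velocity speed \<open>B * \<delta> < r\<close> _ t]
      have in_chart: "\<gamma> \<epsilon> t \<in> fst c" "snd c (\<gamma> \<epsilon> t) \<in> cball x (2 * r)"
        using stays \<open>B > 0\<close> by auto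
      let ?y = "snd c (\<gamma> \<epsilon> t)"
      have "?y \<in> U" "?y \<in> cball x \<rho>"
        using in_chart(2) r by auto
      have D\<Phi>: "(\<Phi> has_derivative frechet_derivative \<Phi> (at ?y)) (at ?y)"
        using C_k_on_open_derivative(1)[OF \<Phi> F(2) U(1) \<open>?y \<in> U\<close>] .
      have "((\<Phi> \<circ> (\<lambda>s. snd c (\<gamma> \<epsilon> s))) has_derivative
          frechet_derivative \<Phi> (at ?y) \<circ> (\<lambda>s. s *\<^sub>R X \<epsilon> (\<gamma> \<epsilon> t) c)) (at t)"
        using velocity[OF in_chart(1)] D\<Phi> unfolding has_vector_derivative_def
        by (rule diff_chain_at)
      moreover have "frechet_derivative \<Phi> (at ?y) \<circ> (\<lambda>s. s *\<^sub>R X \<epsilon> (\<gamma> \<epsilon> t) c) =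
          (*) (frechet_derivative \<Phi> (at ?y) (f (?y, \<epsilon>)))"
        using linear_scale[OF has_derivative_linear[OF D\<Phi>]] f_chart[OF in_chart(1)]
        by (auto simp: mult.commute)
      ultimately have deriv: "((\<Phi> \<circ> (\<lambda>s. snd c (\<gamma> \<epsilon> s))) has_real_derivative
          frechet_derivative \<Phi> (at ?y) (f (?y, \<epsilon>))) (at t)"
        by (simp add: has_field_derivative_def)
      have "openin M (fst c)"
        using c(3) by (simp add: is_chart_def)
      then have "open {s. \<gamma> \<epsilon> s \<in> fst c}"
        using openin_continuous_map_preimage[OF curve] by simp
      then have "((\<lambda>t. F (\<gamma> \<epsilon> t)) has_real_derivative
          frechet_derivative \<Phi> (at ?y) (f (?y, \<epsilon>))) (at t)"
        using in_chart(1) chart(3)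
        by (intro has_field_derivative_transform_within_open[OF deriv]) (auto simp: \<Phi>_def)
      then show "\<exists>d. ((\<lambda>t. F (\<gamma> \<epsilon> t)) has_real_derivative d) (at t) \<and>
          \<bar>d - \<epsilon> * differential A F p (X1 p)\<bar> \<le> \<eta> * \<epsilon>"
        using \<rho>[OF \<open>?y \<in> cball x \<rho>\<close> \<epsilon>(2)] by blast
    qed
  qed
  then show ?thesis
    using \<open>\<delta> > 0\<close> by blast
qed

section \<open>Averaging over one period\<close>

text \<open>
  The compactness and averaging argument, free of geometry. Here \<open>h \<epsilon> t\<close> stands for the first integral along
  the orbit with parameter \<open>\<epsilon>\<close>, and \<open>rate\<close> says that \<open>\<partial>\<^sub>t h / \<epsilon>\<close> tends to \<open>\<psi>\<close> in a locally uniform sense.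
  The hypothesis compares the derivative at nearby \<open>t\<close> with \<open>\<psi> t\<^sub>0\<close> rather than with
  \<open>\<psi> t\<close>; comparing the two estimates at one point \<open>t\<close> shows that \<open>\<psi>\<close> is continuous, hence
  integrable. With \<open>\<Psi>\<close> a primitive of \<open>\<psi>\<close>, the function \<open>h \<epsilon> - \<epsilon> \<Psi>\<close> varies by at most
  \<open>o(\<epsilon>)\<close> on \<open>[0, P \<epsilon>]\<close>, while \<open>h \<epsilon>\<close> returns to its initial value; so \<open>\<Psi> (P \<epsilon>) \<rightarrow> 0\<close>.
\<close>

lemma zero_mean_rate_of_closed_orbits:
  fixes h :: "real \<Rightarrow> real \<Rightarrow> real" and \<psi> P :: "real \<Rightarrow> real" and T :: real
  assumes rate: "\<And>t\<^sub>0 \<eta>. \<eta> > 0 \<Longrightarrow> \<exists>\<delta>>0. \<forall>\<^sub>F \<epsilon> in at_right 0. \<forall>t\<in>cball t\<^sub>0 \<delta>.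
      \<exists>d. (h \<epsilon> has_real_derivative d) (at t) \<and> \<bar>d - \<epsilon> * \<psi> t\<^sub>0\<bar> \<le> \<eta> * \<epsilon>"
    and closed: "\<forall>\<^sub>F \<epsilon> in at_right 0. h \<epsilon> (P \<epsilon>) = h \<epsilon> 0"
    and period: "(P \<longlongrightarrow> T) (at_right 0)" "T > 0"
  shows "(\<psi> has_integral 0) {0..T}"
proof -
  define near where "near \<eta> t\<^sub>0 \<delta> \<epsilon> \<longleftrightarrow> (\<forall>t\<in>cball t\<^sub>0 \<delta>.
      \<exists>d. (h \<epsilon> has_real_derivative d) (at t) \<and> \<bar>d - \<epsilon> * \<psi> t\<^sub>0\<bar> \<le> \<eta> * \<epsilon>)" for \<eta> t\<^sub>0 \<delta> \<epsilon>
  have near: "\<exists>\<delta>>0. eventually (near \<eta> t\<^sub>0 \<delta>) (at_right 0)" if "\<eta> > 0" for \<eta> t\<^sub>0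
    using rate[OF that, of t\<^sub>0] by (simp add: near_def[abs_def])
  have nearD: "\<exists>d. (h \<epsilon> has_real_derivative d) (at t) \<and> \<bar>d - \<epsilon> * \<psi> t\<^sub>0\<bar> \<le> \<eta> * \<epsilon>"
    if "near \<eta> t\<^sub>0 \<delta> \<epsilon>" "t \<in> cball t\<^sub>0 \<delta>" for \<eta> t\<^sub>0 \<delta> \<epsilon> t
    using that unfolding near_def by blast
  have pos: "\<forall>\<^sub>F \<epsilon>::real in at_right 0. \<epsilon> > 0"
    by (rule eventually_at_right_less)
  have osc: "\<bar>\<psi> t - \<psi> t\<^sub>0\<bar> \<le> 2 * \<eta>"
    if near_t\<^sub>0: "eventually (near \<eta> t\<^sub>0 \<delta>) (at_right 0)"
      and t: "t \<in> cball t\<^sub>0 \<delta>" and "\<eta> > 0" for t t\<^sub>0 \<delta> \<eta>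
  proof -
    obtain \<delta>' where "\<delta>' > 0" and ev: "eventually (near \<eta> t \<delta>') (at_right 0)"
      using near[OF \<open>\<eta> > 0\<close>, of t] by blast
    have "\<forall>\<^sub>F \<epsilon> in at_right (0::real). \<bar>\<psi> t - \<psi> t\<^sub>0\<bar> \<le> 2 * \<eta>"
      using ev near_t\<^sub>0 pos
    proof eventually_elim
      case (elim \<epsilon>)
      obtain d where d: "(h \<epsilon> has_real_derivative d) (at t)" "\<bar>d - \<epsilon> * \<psi> t\<^sub>0\<bar> \<le> \<eta> * \<epsilon>"
        using nearD[OF elim(2) t] by blast
      have "t \<in> cball t \<delta>'"
        using \<open>\<delta>' > 0\<close> by simp
      then obtain d' where d': "(h \<epsilon> has_real_derivative d') (at t)" "\<bar>d' - \<epsilon> * \<psi> t\<bar> \<le> \<eta> * \<epsilon>"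
        using nearD[OF elim(1)] by blast
      have "d' = d"
        using d(1) d'(1) DERIV_unique by blast
      then have "\<bar>\<epsilon> * (\<psi> t - \<psi> t\<^sub>0)\<bar> \<le> \<epsilon> * (2 * \<eta>)"
        using d(2) d'(2) by (simp add: algebra_simps)
      then show ?case
        using elim(3) by (simp add: abs_mult)
    qed
    then show ?thesis
      by (simp add: trivial_limit_at_right_real)
  qed
  have "isCont \<psi> t\<^sub>0" for t\<^sub>0
  proof -
    have "\<exists>\<delta>>0. \<forall>t. dist t t\<^sub>0 < \<delta> \<longrightarrow> dist (\<psi> t) (\<psi> t\<^sub>0) < e" if "e > 0" for e
    proof -
      have "e / 3 > 0" using that by simp
      then obtain \<delta> where "\<delta> > 0" and ev: "eventually (near (e / 3) t\<^sub>0 \<delta>) (at_right 0)"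
        using near by blast
      have "dist (\<psi> t) (\<psi> t\<^sub>0) < e" if "dist t t\<^sub>0 < \<delta>" for t
        using osc[OF ev, of t] that \<open>e > 0\<close>
        by (simp add: dist_real_def abs_minus_commute)
      then show ?thesis
        using \<open>\<delta> > 0\<close> by blast
    qed
    then show ?thesis
      unfolding continuous_at_eps_delta by blast
  qed
  then have cont: "continuous_on S \<psi>" for S
    by (simp add: continuous_at_imp_continuous_on)
  \<comment> \<open>The interval extends beyond \<open>T\<close> because \<open>P \<epsilon>\<close> may exceed \<open>T\<close>.\<close>
  have uniform: "\<forall>\<^sub>F \<epsilon> in at_right 0. \<forall>t\<in>{0..T + 1}.
      \<exists>d. (h \<epsilon> has_real_derivative d) (at t) \<and> \<bar>d - \<epsilon> * \<psi> t\<bar> \<le> 3 * \<eta> * \<epsilon>"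
    if \<eta>: "\<eta> > 0" for \<eta>
  proof -
    obtain \<delta> where \<delta>: "\<And>t\<^sub>0. \<delta> t\<^sub>0 > 0" and ev: "\<And>t\<^sub>0. eventually (near \<eta> t\<^sub>0 (\<delta> t\<^sub>0)) (at_right 0)"
      using near[OF \<eta>] by metis
    have "{0..T + 1} \<subseteq> (\<Union>t\<^sub>0\<in>{0..T + 1}. ball t\<^sub>0 (\<delta> t\<^sub>0))"
      using \<delta> by force
    then obtain C where C: "finite C" "{0..T + 1} \<subseteq> (\<Union>t\<^sub>0\<in>C. ball t\<^sub>0 (\<delta> t\<^sub>0))"
      by (rule compactE_image[OF compact_Icc, rotated]) auto
    have "\<forall>\<^sub>F \<epsilon> in at_right 0. \<forall>t\<^sub>0\<in>C. near \<eta> t\<^sub>0 (\<delta> t\<^sub>0) \<epsilon>"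
      using C(1) ev by (simp add: eventually_ball_finite)
    then show ?thesis
      using pos
    proof eventually_elim
      case (elim \<epsilon>)
      show ?case
      proof
        fix t assume "t \<in> {0..T + 1}"
        then obtain t\<^sub>0 where t\<^sub>0: "t\<^sub>0 \<in> C" "t \<in> cball t\<^sub>0 (\<delta> t\<^sub>0)"
          using C(2) ball_subset_cball by blast
        obtain d where d: "(h \<epsilon> has_real_derivative d) (at t)" "\<bar>d - \<epsilon> * \<psi> t\<^sub>0\<bar> \<le> \<eta> * \<epsilon>"
          using elim(1) t\<^sub>0 nearD by blast
        have "\<bar>\<epsilon> * \<psi> t - \<epsilon> * \<psi> t\<^sub>0\<bar> = \<epsilon> * \<bar>\<psi> t - \<psi> t\<^sub>0\<bar>"
          using elim(2) by (metis abs_mult abs_of_pos right_diff_distrib)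
        also have "\<dots> \<le> \<epsilon> * (2 * \<eta>)"
          using osc[OF ev t\<^sub>0(2) \<eta>] elim(2) by simp
        finally have "\<bar>d - \<epsilon> * \<psi> t\<bar> \<le> 3 * \<eta> * \<epsilon>"
          using d(2) by (simp add: algebra_simps)
        then show "\<exists>d. (h \<epsilon> has_real_derivative d) (at t) \<and> \<bar>d - \<epsilon> * \<psi> t\<bar> \<le> 3 * \<eta> * \<epsilon>"
          using d(1) by blast
      qed
    qed
  qed
  define \<Psi> where "\<Psi> t = integral {0..t} \<psi>" for t
  have \<Psi>: "(\<Psi> has_vector_derivative \<psi> t) (at t within {0..T + 1})" if "t \<in> {0..T + 1}" for t
    unfolding \<Psi>_def using integral_has_vector_derivative[OF cont that] .
  have "isCont \<Psi> T"
    using \<Psi>[of T] period(2)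
    by (metis at_within_Icc_at atLeastAtMost_iff has_vector_derivative_continuous
        less_add_one less_eq_real_def)
  then have lim: "((\<lambda>\<epsilon>. \<Psi> (P \<epsilon>)) \<longlongrightarrow> \<Psi> T) (at_right 0)"
    using period(1) isCont_tendsto_compose by blast
  have range: "\<forall>\<^sub>F \<epsilon> in at_right 0. P \<epsilon> \<in> {0<..<T + 1}"
    using period by (intro topological_tendstoD[OF period(1)]) auto
  have small: "\<bar>\<Psi> T\<bar> \<le> 3 * \<eta> * (T + 1)" if \<eta>: "\<eta> > 0" for \<eta>
  proof -
    have "\<forall>\<^sub>F \<epsilon> in at_right 0. \<bar>\<Psi> (P \<epsilon>)\<bar> \<le> 3 * \<eta> * (T + 1)"
      using uniform[OF \<eta>] closed range pos
    proof eventually_elim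
      case (elim \<epsilon>)
      obtain d where d: "\<And>t. t \<in> {0..T + 1} \<Longrightarrow> (h \<epsilon> has_real_derivative d t) (at t)"
        "\<And>t. t \<in> {0..T + 1} \<Longrightarrow> \<bar>d t - \<epsilon> * \<psi> t\<bar> \<le> 3 * \<eta> * \<epsilon>"
        using elim(1) by (metis (no_types))
      define k where "k t = h \<epsilon> t - \<epsilon> * \<Psi> t" for t
      have k: "(k has_real_derivative (d t - \<epsilon> * \<psi> t)) (at t within {0..T + 1})"
        if "t \<in> {0..T + 1}" for t
        unfolding k_def using \<Psi>[OF that]
        by (intro DERIV_diff DERIV_cmult has_field_derivative_at_within[OF d(1)[OF that]])
          (simp add: has_real_derivative_iff_has_vector_derivative)
      have "norm (k (P \<epsilon>) - k 0) \<le> 3 * \<eta> * \<epsilon> * norm (P \<epsilon> - 0)"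
        using k d(2) elim(3) by (intro field_differentiable_bound[where S = "{0..T + 1}"]) auto
      then have "\<epsilon> * \<bar>\<Psi> (P \<epsilon>)\<bar> \<le> \<epsilon> * (3 * \<eta> * P \<epsilon>)"
        using elim by (simp add: k_def \<Psi>_def abs_mult algebra_simps)
      then have "\<bar>\<Psi> (P \<epsilon>)\<bar> \<le> 3 * \<eta> * P \<epsilon>"
        using elim(4) by simp
      also have "\<dots> \<le> 3 * \<eta> * (T + 1)"
        using \<eta> elim(3) by simp
      finally show ?case .
    qed
    then show ?thesis
      using tendsto_upperbound[OF tendsto_rabs[OF lim]] by (simp add: trivial_limit_at_right_real)
  qed
  have "\<bar>\<Psi> T\<bar> \<le> 0"
  proof (rule field_le_epsilon)
    fix e :: real assume "e > 0"
    moreover have "3 * (e / (3 * (T + 1))) * (T + 1) = e"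
      using period(2) by (simp add: field_simps add_pos_pos)
    ultimately show "\<bar>\<Psi> T\<bar> \<le> 0 + e"
      using small[of "e / (3 * (T + 1))"] period(2) by simp
  qed
  then show ?thesis
    using integrable_continuous_interval[OF cont, of 0 T] unfolding \<Psi>_def
    by (simp add: has_integral_iff)
qed

theorem theorem2p1:
  fixes M :: "'m topology"
    and A :: "('m, 'n::finite) chart set"
    and X :: "real \<Rightarrow> 'm \<Rightarrow> ('m, 'n) tangent_vector"
    and X0 X1 :: "'m \<Rightarrow> ('m, 'n) tangent_vector"
    and \<epsilon>\<^sub>0 T :: real
    and \<gamma> :: "real \<Rightarrow> 'm"
    and N :: "'m set"
    and F :: "'m \<Rightarrow> real"
    and T\<^sub>p :: "real \<Rightarrow> real"
    and \<gamma>\<^sub>p :: "real \<Rightarrow> real \<Rightarrow> 'm"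
  assumes dim: "CARD('n) \<ge> 2"
    and manifold: "oriented_manifold 3 M A"
    and eps0: "\<epsilon>\<^sub>0 > 0"
    and family: "C_k_vector_field_family M A 2 {0..<\<epsilon>\<^sub>0} X"
    and X0: "vector_field M A X0"
    and X1: "vector_field M A X1"
    and expansion: "\<And>c p. c \<in> A \<Longrightarrow> p \<in> fst c \<Longrightarrow>
      (\<lambda>\<epsilon>. norm (X \<epsilon> p c - (X0 p c + \<epsilon> *\<^sub>R X1 p c))) \<in> O[at_right 0](\<lambda>\<epsilon>. \<epsilon>\<^sup>2)"
    and unperturbed: "periodic_orbit M A X0 T \<gamma>"
    and nbhd: "openin M N" "\<gamma> ` {0..<T} \<subseteq> N"
    and integral: "first_integral A 3 N X0 F"
    and perturbed: "\<And>\<epsilon>. \<epsilon> \<in> {0..<\<epsilon>\<^sub>0} \<Longrightarrow> periodic_orbit M A (X \<epsilon>) (T\<^sub>p \<epsilon>) (\<gamma>\<^sub>p \<epsilon>)"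
    and period_C2: "C_k_on 2 {0..<\<epsilon>\<^sub>0} T\<^sub>p"
    and orbit_C2: "\<And>t. C_k_curve M A 2 {0..<\<epsilon>\<^sub>0} (\<lambda>\<epsilon>. \<gamma>\<^sub>p \<epsilon> t)"
    and at_zero: "T\<^sub>p 0 = T" "\<gamma>\<^sub>p 0 = \<gamma>"
  shows "((\<lambda>t. differential A F (\<gamma> t) (X1 (\<gamma> t))) has_integral 0) {0..T}"
proof -
  have in_N: "\<gamma> t \<in> N" for t
  proof -
    \<comment> \<open>Every time is shifted into \<open>{0..<T}\<close> by a multiple of the period.\<close>
    have "\<gamma> (t + of_int k * T) = \<gamma> t" for k :: int and t
    proof -
      interpret periodic_fun_simple \<gamma> T
        using unperturbed by unfold_locales (simp add: periodic_orbit_def)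
      show ?thesis
        by (rule plus_of_int)
    qed
    from this[of "t" "- \<lfloor>t / T\<rfloor>"] have "\<gamma> t = \<gamma> (t - \<lfloor>t / T\<rfloor> * T)"
      by simp
    moreover have "t - \<lfloor>t / T\<rfloor> * T \<in> {0..<T}"
    proof -
      have "T > 0" using unperturbed by (simp add: periodic_orbit_def)
      then show ?thesis
        using floor_divide_lower[of T t] floor_divide_upper[of T t] by (simp add: algebra_simps)
    qed
    ultimately show ?thesis
      using nbhd by auto
  qed
  have at_0: "at 0 within {0..<\<epsilon>\<^sub>0} = at_right 0"
    using eps0 by (rule at_within_half_open_interval)
  have lim: "limitin M (\<lambda>\<epsilon>. \<gamma>\<^sub>p \<epsilon> t) (\<gamma> t) (at_right 0)" for t
  proof -
    have "continuous_map (top_of_set {0..<\<epsilon>\<^sub>0}) M (\<lambda>\<epsilon>. \<gamma>\<^sub>p \<epsilon> t)"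
      using orbit_C2 by (simp add: C_k_curve_def)
    moreover have "\<forall>\<^sub>F \<epsilon> in at_right 0. \<epsilon> \<in> {0..<\<epsilon>\<^sub>0}"
      using eventually_at_right_real[OF eps0] by (auto elim: eventually_mono)
    then have "limitin (top_of_set {0..<\<epsilon>\<^sub>0}) (\<lambda>\<epsilon>. \<epsilon>) 0 (at_right 0)"
      using eps0 by (simp add: limitin_subtopology)
    ultimately show ?thesis
      using continuous_map_limit at_zero(2) by (fastforce simp: o_def)
  qed
  have "continuous_on {0..<\<epsilon>\<^sub>0} T\<^sub>p"
    using period_C2 by (rule C_k_on_imp_continuous_on)
  then have period: "(T\<^sub>p \<longlongrightarrow> T) (at_right 0)"
    using eps0 unfolding continuous_on_def by (simp flip: at_0 at_zero(1))
  have curves: "integral_curve M A (X \<epsilon>) (\<gamma>\<^sub>p \<epsilon>)" if "\<epsilon> \<in> {0..<\<epsilon>\<^sub>0}" for \<epsilon>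
    using perturbed[OF that] by (simp add: periodic_orbit_def)
  have "\<forall>\<^sub>F \<epsilon> in at_right 0. \<epsilon> \<in> {0<..<\<epsilon>\<^sub>0}"
    using eps0 by (rule eventually_at_right_real)
  then have closed: "\<forall>\<^sub>F \<epsilon> in at_right 0. F (\<gamma>\<^sub>p \<epsilon> (T\<^sub>p \<epsilon>)) = F (\<gamma>\<^sub>p \<epsilon> 0)"
  proof eventually_elim
    case (elim \<epsilon>)
    then have "\<gamma>\<^sub>p \<epsilon> (0 + T\<^sub>p \<epsilon>) = \<gamma>\<^sub>p \<epsilon> 0"
      using perturbed[of \<epsilon>] unfolding periodic_orbit_def by fastforce
    then show ?case
      by simp
  qed
  have "T > 0"
    using unperturbed by (simp add: periodic_orbit_def)
  show ?thesis
  proof (rule zero_mean_rate_of_closed_orbits[where h = "\<lambda>\<epsilon> t. F (\<gamma>\<^sub>p \<epsilon> t)", OF _ closed period \<open>T > 0\<close>])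
    fix t\<^sub>0 \<eta> :: real assume "\<eta> > 0"
    show "\<exists>\<delta>>0. \<forall>\<^sub>F \<epsilon> in at_right 0. \<forall>t\<in>cball t\<^sub>0 \<delta>.
      \<exists>d. ((\<lambda>t. F (\<gamma>\<^sub>p \<epsilon> t)) has_real_derivative d) (at t) \<and>
        \<bar>d - \<epsilon> * differential A F (\<gamma> t\<^sub>0) (X1 (\<gamma> t\<^sub>0))\<bar> \<le> \<eta> * \<epsilon>"
      using first_integral_rate_near_orbit_point[OF manifold _ eps0 family _ X0 X1 expansion nbhd(1)
          integral _ curves lim in_N \<open>\<eta> > 0\<close>] by simp
  qed
qed

end
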